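(* Consider the delay differential equation $\dot z(t)=f(z(t),z(t-1),\alpha)$ with $z\in\mathbb{R}^n$, $\alpha\in\mathbb{R}^2$, $f=f(z_1,z_2,\alpha)$ of class $C^r$ ($r\ge2$), $f(0,0,\alpha)=0$ for all $\alpha\in\mathbb{R}^2$, and let $A=\frac{\partial f}{\partial z_1}(0,0,0)$, $B=\frac{\partial f}{\partial z_2}(0,0,0)$. Assume that $0$ is a root of $\det(\mu I-A-Be^{-\mu})=0$ with algebraic multiplicity $2$ and geometric multiplicity $1$, and that all other roots have nonzero real parts. Then the forward Euler scheme with step size $\varepsilon=\frac1m$, $m\in\mathbb{Z}_+$, $$z_{k+1}=z_k+\varepsilon f(z_k,z_{k-m},\alpha),$$ undergoes a $1{:}1$ resonance at $(z,\alpha)=(0,0)$.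
   Context: The scheme is regarded as a map on $\mathbb{R}^{(m+1)n}$ in the variable $u_k=(z_k^T,z_{k-1}^T,\dots,z_{k-m}^T)^T$. Its linearization at $(u,\alpha)=(0,0)$ is $u_{k+1}=Cu_k$, where $C$ is the $(m+1)n\times(m+1)n$ block matrix whose first block row is $(I+\varepsilon A,0,\dots,0,\varepsilon B)$ and whose remaining block rows have the identity on the block subdiagonal and zeros elsewhere. "The scheme undergoes a $1{:}1$ resonance at $(z,\alpha)=(0,0)$" means: $1$ is an eigenvalue of $C$ with algebraic multiplicity $2$ and geometric multiplicity $1$, and $C$ has no other eigenvalue of modulus $1$. (Algebraic multiplicity of the root $0$: its multiplicity as a zero of $\mu\mapsto\det(\mu I-A-Be^{-\mu})$; geometric multiplicity: $\dim\ker(A+B)$.)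
   Formalization: Proved for all sufficiently large m (step size 1/m small enough, threshold depending on f), not for every positive integer m; for every m it is false: with m=1, A=diag(1,-2), B=diag(-1,0) all hypotheses hold but the scheme has the eigenvalue -1. *)

theory Defs
  imports
    "HOL-Complex_Analysis.Complex_Analysis"
    "Jordan_Normal_Form.Jordan_Normal_Form_Uniqueness"
begin

hide_const (open) Coset.order

text \<open>
  The right-hand side lives on the types \<open>real ^ 'n\<close>.  The phase space of the Euler map has
  dimension \<open>(m + 1) * CARD('n)\<close>, which varies with \<open>m\<close>, so it uses vectors and matrices with
  explicit dimensions.
\<close>

text \<open>Class \<open>C\<^sup>r\<close> on the whole space, through iterated directional derivatives.\<close>

primrec Ck :: "nat \<Rightarrow> ('a::euclidean_space \<Rightarrow> 'b::real_normed_vector) \<Rightarrow> bool" where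
  "Ck 0 f \<longleftrightarrow> continuous_on UNIV f"
| "Ck (Suc k) f \<longleftrightarrow> (\<forall>x. f differentiable (at x)) \<and>
     (\<forall>v. Ck k (\<lambda>x. frechet_derivative f (at x) v))"

definition char_fun :: "real ^ 'n ^ 'n \<Rightarrow> real ^ 'n ^ 'n \<Rightarrow> complex \<Rightarrow> complex" where
  "char_fun A B \<mu> =
     Determinants.det (Finite_Cartesian_Product.mat \<mu> - map_matrix complex_of_real A
       - map_matrix (\<lambda>b. complex_of_real b * exp (- \<mu>)) B)"

text \<open>
  The function \<open>char_fun A B\<close> is entire and never identically zero (it is asymptotic to \<open>\<mu> ^ n\<close>
  as \<open>Re \<mu> \<rightarrow> \<infinity>\<close>), so \<open>zorder\<close> is its vanishing order, \<open>0\<close> at points that are not roots.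
\<close>

definition root_alg_mult :: "real ^ 'n ^ 'n \<Rightarrow> real ^ 'n ^ 'n \<Rightarrow> complex \<Rightarrow> int" where
  "root_alg_mult A B \<mu> = zorder (char_fun A B) \<mu>"

definition zero_root_geom_mult :: "real ^ 'n ^ 'n \<Rightarrow> real ^ 'n ^ 'n \<Rightarrow> nat" where
  "zero_root_geom_mult A B = dim {x. (A + B) *v x = 0}"

text \<open>
  A state \<open>u = (z\<^sub>k, z\<^sub>k\<^sub>-\<^sub>1, \<dots>, z\<^sub>k\<^sub>-\<^sub>m)\<close> is stored block after block; inside a block the components
  are ordered by the enumeration \<open>from_nat_into UNIV\<close> of the index type, with inverse
  \<open>to_nat_on UNIV\<close>.
\<close>

definition state_block :: "nat \<Rightarrow> real Matrix.vec \<Rightarrow> real ^ 'n" where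
  "state_block i u = (\<chi> a. vec_index u (i * CARD('n) + to_nat_on UNIV a))"

definition euler_map ::
  "(real ^ 'n \<Rightarrow> real ^ 'n \<Rightarrow> 'p \<Rightarrow> real ^ 'n) \<Rightarrow> nat \<Rightarrow> 'p \<Rightarrow> real Matrix.vec \<Rightarrow> real Matrix.vec" where
  "euler_map f m \<alpha> u = Matrix.vec ((m + 1) * CARD('n)) (\<lambda>k.
     if k < CARD('n)
     then (state_block 0 u + (1 / real m) *\<^sub>R f (state_block 0 u) (state_block m u) \<alpha>)
            $ from_nat_into UNIV k
     else vec_index u (k - CARD('n)))"

definition linearization_at_0 :: "nat \<Rightarrow> (real Matrix.vec \<Rightarrow> real Matrix.vec) \<Rightarrow> real mat" where
  "linearization_at_0 N F = Matrix.mat N N (\<lambda>(k, l).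
     deriv (\<lambda>t. vec_index (F (t \<cdot>\<^sub>v unit_vec N l)) k) 0)"

text \<open>
  The \<open>1:1\<close> resonance of a parametrised family \<open>F \<alpha>\<close> of maps on \<open>N\<close>-dimensional space, at
  state \<open>0\<close> and parameter \<open>0\<close>.

  For the Euler map with step size \<open>1 / m\<close> this can only be expected for \<open>m\<close> beyond a threshold
  depending on the equation.  The linear equation with \<open>A = diag(1, -2m)\<close> and \<open>B = diag(-1, 0)\<close>
  has characteristic function \<open>(\<mu> - 1 + exp (- \<mu>)) * (\<mu> + 2 * m)\<close>, whose only root on the
  imaginary axis is the double root \<open>0\<close>, but for that \<open>m\<close> the second component of the Euler map
  is \<open>z \<mapsto> -z\<close>, which gives the further eigenvalue \<open>-1\<close> of modulus \<open>1\<close>.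
\<close>

definition one_one_resonance ::
  "nat \<Rightarrow> ('p::zero \<Rightarrow> real Matrix.vec \<Rightarrow> real Matrix.vec) \<Rightarrow> bool" where
  "one_one_resonance N F \<longleftrightarrow>
     (let C = map_mat complex_of_real (linearization_at_0 N (F 0)) in
        eigenvalue C 1 \<and>
        Polynomial.order 1 (char_poly C) = 2 \<and>
        kernel_dim (char_matrix C 1) = 1 \<and>
        (\<forall>\<rho>. eigenvalue C \<rho> \<and> cmod \<rho> = 1 \<longrightarrow> \<rho> = 1))"

text \<open>
  For the Euler map the linearization is the usual block companion matrix.
\<close>

definition euler_block :: "real ^ 'n ^ 'n \<Rightarrow> real ^ 'n ^ 'n \<Rightarrow> nat \<Rightarrow> nat \<Rightarrow> nat \<Rightarrow> real ^ 'n ^ 'n" where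
  "euler_block A B m i j =
     (if i = 0 \<and> j = 0 then Finite_Cartesian_Product.mat 1 + (1 / real m) *\<^sub>R A
      else if i = 0 \<and> j = m then (1 / real m) *\<^sub>R B
      else if i = j + 1 then Finite_Cartesian_Product.mat 1
      else 0)"

definition euler_matrix :: "real ^ 'n ^ 'n \<Rightarrow> real ^ 'n ^ 'n \<Rightarrow> nat \<Rightarrow> real mat" where
  "euler_matrix A B m = Matrix.mat ((m + 1) * CARD('n)) ((m + 1) * CARD('n)) (\<lambda>(k, l).
     euler_block A B m (k div CARD('n)) (l div CARD('n))
       $ from_nat_into UNIV (k mod CARD('n)) $ from_nat_into UNIV (l mod CARD('n)))"

lemma to_nat_on_less: "to_nat_on (UNIV :: 'n::finite set) a < CARD('n)"
  using to_nat_on_finite[of "UNIV :: 'n set"] by (auto simp: bij_betw_def)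

lemma to_nat_on_UNIV_eq_iff:
  fixes a :: "'n::finite"
  assumes "b < CARD('n)"
  shows "to_nat_on UNIV a = b \<longleftrightarrow> a = from_nat_into UNIV b"
  using assms to_nat_on_finite[of "UNIV :: 'n set"]
  by (metis UNIV_I UNIV_not_empty bij_betw_def bij_betw_from_nat_into_finite countable_finite
      finite from_nat_into_to_nat_on inj_on_eq_iff lessThan_iff to_nat_on_less)

lemma state_block_unit_vec:
  assumes "l < N" "(i + 1) * CARD('n) \<le> N"
  shows "(state_block i (t \<cdot>\<^sub>v unit_vec N l) :: real ^ 'n) =
    t *\<^sub>R (if l div CARD('n) = i then axis (from_nat_into UNIV (l mod CARD('n))) 1 else 0)"
proof -
  have "vec_index (t \<cdot>\<^sub>v unit_vec N l) (i * CARD('n) + to_nat_on UNIV a) =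
     (t *\<^sub>R (if l div CARD('n) = i then axis (from_nat_into UNIV (l mod CARD('n))) 1 else 0)) $ a"
    for a :: 'n
  proof -
    have a: "to_nat_on UNIV a < CARD('n)" by (rule to_nat_on_less)
    have lt: "i * CARD('n) + to_nat_on UNIV a < N" using a assms(2) by simp
    have "i * CARD('n) + to_nat_on UNIV a = l \<longleftrightarrow>
        l div CARD('n) = i \<and> to_nat_on UNIV a = l mod CARD('n)"
      using a by (metis add.commute div_mod_decomp div_mult_self1 div_less mod_less
          mod_mult_self1 add_0_right zero_less_card_finite less_irrefl mult.commute)
    then show ?thesis
      using lt assms(1) to_nat_on_UNIV_eq_iff[of "l mod CARD('n)" a]
      by (auto simp: axis_def)
  qed
  then show ?thesis unfolding state_block_def Finite_Cartesian_Product.vec_eq_iff by simp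
qed

lemma linearization_euler_map:
  fixes f :: "real ^ 'n \<Rightarrow> real ^ 'n \<Rightarrow> 'p::zero \<Rightarrow> real ^ 'n"
  assumes f: "(\<lambda>(x, y). f x y 0) differentiable (at (0, 0))" and m: "m \<ge> 1"
  shows "linearization_at_0 ((m + 1) * CARD('n)) (euler_map f m 0) =
    euler_matrix (jacobian (\<lambda>x. f x 0 0) (at 0)) (jacobian (\<lambda>y. f 0 y 0) (at 0)) m"
proof -
  define n where "n = CARD('n)"
  define N where "N = (m + 1) * n"
  define A where "A = jacobian (\<lambda>x. f x 0 0) (at 0)"
  define B where "B = jacobian (\<lambda>y. f 0 y 0) (at 0)"
  have n0: "n > 0" by (simp add: n_def)
  obtain D where D: "((\<lambda>(x, y). f x y 0) has_derivative D) (at (0, 0))"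
    using f by (auto simp: differentiable_def)
  have lin: "linear D" by (rule has_derivative_linear[OF D])
  have DA: "((\<lambda>x. f x 0 0) has_derivative (\<lambda>h. D (h, 0))) (at 0)"
  proof -
    have "((\<lambda>x::real^'n. (x, 0::real^'n)) has_derivative (\<lambda>h. (h, 0))) (at 0)"
      by (auto intro!: derivative_eq_intros)
    from has_derivative_compose[OF this, of "\<lambda>(x, y). f x y 0" D] D show ?thesis by simp
  qed
  have DB: "((\<lambda>y. f 0 y 0) has_derivative (\<lambda>h. D (0, h))) (at 0)"
  proof -
    have "((\<lambda>y::real^'n. (0::real^'n, y)) has_derivative (\<lambda>h. (0, h))) (at 0)"
      by (auto intro!: derivative_eq_intros)
    from has_derivative_compose[OF this, of "\<lambda>(x, y). f x y 0" D] D show ?thesis by simp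
  qed
  have A: "D (h, 0) = A *v h" for h
    using DA jacobian_works[of "\<lambda>x. f x 0 0" "at 0"] has_derivative_unique[OF DA]
    unfolding A_def differentiable_def by metis
  have B: "D (0, h) = B *v h" for h
    using DB jacobian_works[of "\<lambda>x. f 0 x 0" "at 0"] has_derivative_unique[OF DB]
    unfolding B_def differentiable_def by metis
  have Dsplit: "D (p, q) = A *v p + B *v q" for p q
    using linear_add[OF lin, of "(p, 0)" "(0, q)"] by (simp add: A B)
  have "deriv (\<lambda>t. vec_index (euler_map f m 0 (t \<cdot>\<^sub>v unit_vec N l)) k) 0 =
      euler_block A B m (k div n) (l div n)
       $ from_nat_into UNIV (k mod n) $ from_nat_into UNIV (l mod n)"
    if k: "k < N" and l: "l < N" for k l
  proof (cases "k < n")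
    case True
    define a :: 'n where "a = from_nat_into UNIV k"
    define b :: 'n where "b = from_nat_into UNIV (l mod n)"
    define p :: "real ^ 'n" where "p = (if l div n = 0 then axis b 1 else 0)"
    define q :: "real ^ 'n" where "q = (if l div n = m then axis b 1 else 0)"
    have "state_block 0 (t \<cdot>\<^sub>v unit_vec N l) = t *\<^sub>R p"
         "state_block m (t \<cdot>\<^sub>v unit_vec N l) = t *\<^sub>R q" for t
      using state_block_unit_vec[where 'n='n, OF l, of 0 t]
        state_block_unit_vec[where 'n='n, OF l, of m t]
      unfolding p_def q_def b_def by (simp_all add: N_def n_def)
    then have eq: "(\<lambda>t. vec_index (euler_map f m 0 (t \<cdot>\<^sub>v unit_vec N l)) k) =
        (\<lambda>t. (t *\<^sub>R p + (1 / real m) *\<^sub>R f (t *\<^sub>R p) (t *\<^sub>R q) 0) $ a)"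
      using k True by (simp add: euler_map_def N_def n_def a_def)
    have "((\<lambda>t. (t *\<^sub>R p, t *\<^sub>R q)) has_derivative (\<lambda>h. (h *\<^sub>R p, h *\<^sub>R q))) (at 0)"
      by (auto intro!: derivative_eq_intros)
    from has_derivative_compose[OF this, of "\<lambda>(x, y). f x y 0" D] D
    have "((\<lambda>t. f (t *\<^sub>R p) (t *\<^sub>R q) 0) has_derivative (\<lambda>h. D (h *\<^sub>R p, h *\<^sub>R q))) (at 0)"
      by simp
    then have "((\<lambda>t. (t *\<^sub>R p + (1 / real m) *\<^sub>R f (t *\<^sub>R p) (t *\<^sub>R q) 0) $ a) has_derivative
        (\<lambda>h. (h *\<^sub>R p + (1 / real m) *\<^sub>R D (h *\<^sub>R p, h *\<^sub>R q)) $ a)) (at 0)"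
      by (intro bounded_linear.has_derivative[OF bounded_linear_vec_nth] has_derivative_add
          has_derivative_scaleR_left has_derivative_scaleR_right has_derivative_ident)
    moreover have "(\<lambda>h. (h *\<^sub>R p + (1 / real m) *\<^sub>R D (h *\<^sub>R p, h *\<^sub>R q)) $ a) =
        (*) ((p + (1 / real m) *\<^sub>R (A *v p + B *v q)) $ a)"
      using linear_scale[OF lin, of _ "(p, q)"] by (auto simp: Dsplit algebra_simps)
    ultimately have "((\<lambda>t. (t *\<^sub>R p + (1 / real m) *\<^sub>R f (t *\<^sub>R p) (t *\<^sub>R q) 0) $ a)
        has_field_derivative (p + (1 / real m) *\<^sub>R (A *v p + B *v q)) $ a) (at 0)"
      unfolding has_field_derivative_def by simp
    then have "deriv (\<lambda>t. vec_index (euler_map f m 0 (t \<cdot>\<^sub>v unit_vec N l)) k) 0 =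
        (p + (1 / real m) *\<^sub>R (A *v p + B *v q)) $ a"
      unfolding eq by (rule DERIV_imp_deriv)
    also have "\<dots> = euler_block A B m 0 (l div n) $ a $ b"
    proof -
      have col: "(M *v axis b 1) $ a = M $ a $ b" for M :: "real ^ 'n ^ 'n"
        by (simp add: matrix_vector_mult_basis column_def)
      have "(axis b 1 :: real ^ 'n) $ a = Finite_Cartesian_Product.mat 1 $ a $ b"
        by (simp add: axis_def Finite_Cartesian_Product.mat_def)
      with m show ?thesis by (auto simp: p_def q_def euler_block_def col)
    qed
    finally show ?thesis using True by (simp add: a_def b_def)
  next
    case False
    have "(\<lambda>t. vec_index (euler_map f m 0 (t \<cdot>\<^sub>v unit_vec N l)) k) =
        (\<lambda>t. t * (if k - n = l then 1 else 0))"
      using k l False n0 by (auto simp: euler_map_def N_def n_def fun_eq_iff)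
    moreover have "deriv (\<lambda>t. t * (if k - n = l then 1 else 0 :: real)) 0 =
        (if k - n = l then 1 else 0)"
      by (rule DERIV_imp_deriv) (auto intro!: derivative_eq_intros)
    moreover have "k - n = l \<longleftrightarrow> k div n = l div n + 1 \<and> k mod n = l mod n"
      using False n0
      by (metis Suc_eq_plus1 add_diff_inverse_nat div_add_self1 div_mod_decomp mod_add_self1
          add.commute less_numeral_extra(3) nat_neq_iff diff_add_inverse2)
    moreover have "k div n \<noteq> 0" using False n0 by (simp add: div_eq_0_iff)
    moreover have "from_nat_into UNIV (k mod n) = (from_nat_into UNIV (l mod n) :: 'n) \<longleftrightarrow>
        k mod n = l mod n"
      using n0 to_nat_on_UNIV_eq_iff[where 'n='n] unfolding n_def
      by (metis mod_less_divisor)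
    ultimately show ?thesis by (auto simp: euler_block_def Finite_Cartesian_Product.mat_def)
  qed
  then show ?thesis
    unfolding linearization_at_0_def euler_matrix_def A_def[symmetric] B_def[symmetric]
      n_def[symmetric] N_def[symmetric]
    by (intro eq_matI) auto
qed

end

theory Submission
  imports Defs
begin

text \<open>
  Substituting \<open>\<rho> = exp (\<mu> / m)\<close>, the characteristic polynomial of the companion matrix becomes,
  up to a nonvanishing factor, \<open>det (m * (exp (\<mu> / m) - 1) I - A - B exp (-\<mu>))\<close>.  As
  \<open>m \<rightarrow> \<infinity>\<close> this converges to the characteristic function of the delay equation, uniformly on
  compact sets, and both have the same value and derivative at \<open>0\<close>.  So for large \<open>m\<close> the double
  zero at \<open>0\<close> persists exactly and no other zero lies in a fixed disc around \<open>0\<close>.  A zero with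
  \<open>\<bar>\<rho>\<bar> = 1\<close> makes \<open>m * (\<rho> - 1)\<close> an eigenvalue of \<open>A + \<rho> ^ (-m) B\<close>, hence bounded
  independently of \<open>m\<close>; so \<open>\<mu>\<close> lies in a fixed compact part of the imaginary axis, where the limit
  has no zero but \<open>0\<close>.
\<close>

unbundle no fps_syntax
no_notation vec_index (infixl "$" 100)

section \<open>Determinants over index types and over explicit dimensions\<close>

text \<open>Induction over transpositions: transport along \<open>f\<close> turns a transposition
  into a transposition, of distinct points by injectivity, so both signs flip together.\<close>

lemma sign_map_permutation:
  assumes "p permutes A" "finite A" "inj_on f A"
  shows "sign (map_permutation A f p) = sign p"
  using assms(1,2)
proof (induction rule: permutes_induct)
  case id
  then show ?case using map_permutation_ident'[OF assms(3)] by (simp add: id_def)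
next
  case (swap a b p)
  have f: "bij_betw f A (f ` A)" using assms(3) by (rule inj_on_imp_bij_betw)
  have "map_permutation A f p permutes f ` A"
    using map_permutation_permutes[OF f] swap by blast
  then have perm: "permutation (map_permutation A f p)"
    using assms(2) by (auto simp: permutation_permutes)
  have perm': "permutation p"
    using swap assms(2) by (auto simp: permutation_permutes)
  have "map_permutation A f (Transposition.transpose a b \<circ> p) =
      Transposition.transpose (f a) (f b) \<circ> map_permutation A f p"
    using swap assms by (simp add: map_permutation_compose' map_permutation_transpose)
  moreover have "f a \<noteq> f b" using swap assms by (auto dest: inj_onD)
  ultimately show ?case
    using swap.hyps swap.IH
    by (simp only: sign_compose[OF permutation_swap_id perm] sign_compose[OF permutation_swap_id perm']
        sign_swap_id if_False)
qed

text \<open>The two Leibniz sums agree term by term when permutations are conjugated by the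
  enumeration of the index type.\<close>

lemma det_mat_from_nat_into:
  fixes M :: "'a::comm_ring_1 ^ 'n ^ 'n"
  shows "Determinant.det (Matrix.mat CARD('n) CARD('n)
      (\<lambda>(i, j). M $ from_nat_into UNIV i $ from_nat_into UNIV j)) = Determinants.det M"
proof -
  define n where "n = CARD('n)"
  define e where "e = from_nat_into (UNIV :: 'n set)"
  define e' where "e' = inv_into {0..<n} e"
  have e: "bij_betw e {0..<n} UNIV"
    using bij_betw_from_nat_into_finite[of "UNIV :: 'n set"]
    by (simp add: e_def n_def lessThan_atLeast0)
  have e': "bij_betw e' UNIV {0..<n}" unfolding e'_def by (rule bij_betw_inv_into[OF e])
  have e'e: "e' (e i) = i" if "i \<in> {0..<n}" for i
    using bij_betw_inv_into_left[OF e that] by (simp add: e'_def)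
  have ee': "e (e' a) = a" for a
    using bij_betw_inv_into_right[OF e, of a] by (simp add: e'_def)
  have "(\<Sum>p | p permutes {0..<n}. signof p * (\<Prod>i = 0..<n. M $ e i $ e (p i))) =
      (\<Sum>q | q permutes (UNIV :: 'n set). of_int (sign q) * (\<Prod>a\<in>UNIV. M $ a $ q a))"
  proof (rule sum.reindex_bij_witness[where i = "map_permutation UNIV e'"
        and j = "map_permutation {0..<n} e"], goal_cases)
    case (1 p)
    then show ?case using map_permutation_compose_inv[OF e] e'e by auto
  next
    case (2 p)
    then show ?case using map_permutation_permutes[OF e] by auto
  next
    case (3 q)
    then show ?case using map_permutation_compose_inv[OF e'] ee' by auto
  next
    case (4 q)
    then show ?case using map_permutation_permutes[OF e'] by auto
  next
    case (5 p)
    then have p: "p permutes {0..<n}" by simp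
    have inj: "inj_on e {0..<n}" using e by (rule bij_betw_imp_inj_on)
    have "(\<Prod>a\<in>UNIV. M $ a $ map_permutation {0..<n} e p a) =
        (\<Prod>i = 0..<n. M $ e i $ map_permutation {0..<n} e p (e i))"
      by (rule prod.reindex_bij_betw[OF e, symmetric])
    also have "\<dots> = (\<Prod>i = 0..<n. M $ e i $ e (p i))"
      using map_permutation_apply[OF inj] by (intro prod.cong) auto
    finally show ?case using sign_map_permutation[OF p _ inj] by simp
  qed
  then show ?thesis
    unfolding Determinants.det_def
    by (subst det_def'[of _ n]) (auto simp: n_def e_def intro!: sum.cong prod.cong)
qed

section \<open>The characteristic polynomial of the companion matrix\<close>

lemma sum_lessThan_blocks:
  fixes f :: "nat \<Rightarrow> 'a::comm_monoid_add"
  shows "(\<Sum>j<p * n. f j) = (\<Sum>i<p. \<Sum>b<n. f (i * n + b))"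
proof -
  have "(\<Sum>j\<in>{i * n..<i * n + n}. f j) = (\<Sum>b<n. f (i * n + b))" for i
    by (rule sum.reindex_bij_witness[where i = "\<lambda>b. i * n + b" and j = "\<lambda>j. j - i * n"]) auto
  then show ?thesis by (simp flip: sum.nat_group)
qed

text \<open>The entries of \<open>euler_matrix\<close> are evaluated only here. The arbitrary
  \<open>F\<close> lets the formula serve both for the columns of a transforming matrix and for
  vectors in a kernel.\<close>

lemma euler_matrix_row:
  fixes A B :: "real ^ 'n ^ 'n" and F :: "nat \<Rightarrow> complex"
  assumes m: "m \<ge> 1" and k: "k < (m + 1) * CARD('n)"
  shows "(\<Sum>j<(m + 1) * CARD('n). complex_of_real (euler_matrix A B m $$ (k, j)) * F j) =
    (if k < CARD('n)
     then F k + (\<Sum>b<CARD('n). complex_of_real (A $ from_nat_into UNIV k $ from_nat_into UNIV b) * F b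
       + complex_of_real (B $ from_nat_into UNIV k $ from_nat_into UNIV b) * F (m * CARD('n) + b)) / of_nat m
     else F (k - CARD('n)))"
proof -
  define n where "n = CARD('n)"
  define e where "e = from_nat_into (UNIV :: 'n set)"
  have n0: "n > 0" by (simp add: n_def)
  have e_iff: "e i = e j \<longleftrightarrow> i = j" if "i < n" "j < n" for i j
    using that to_nat_on_UNIV_eq_iff[where 'n='n] unfolding n_def e_def by metis
  have k': "k < (m + 1) * n" using k by (simp add: n_def)
  have entry: "euler_matrix A B m $$ (k, j) =
      euler_block A B m (k div n) (j div n) $ e (k mod n) $ e (j mod n)" if "j < (m + 1) * n" for j
    using that k by (simp add: euler_matrix_def n_def e_def)
  show ?thesis
  proof (cases "k < n")
    case True
    have "(\<Sum>j<(m + 1) * n. complex_of_real (euler_matrix A B m $$ (k, j)) * F j) =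
        (\<Sum>i<m + 1. \<Sum>b<n. of_real (euler_matrix A B m $$ (k, i * n + b)) * F (i * n + b))"
      by (rule sum_lessThan_blocks)
    also have "\<dots> = (\<Sum>i<m + 1. \<Sum>b<n. of_real (euler_block A B m 0 i $ e k $ e b) * F (i * n + b))"
    proof (intro sum.cong refl)
      fix i b assume "i \<in> {..<m + 1}" "b \<in> {..<n}"
      then have "i * n + b < (m + 1) * n" "b < n"
        by (auto simp: less_Suc_eq_le intro: order.strict_trans2[of _ "i * n + n"])
      then show "complex_of_real (euler_matrix A B m $$ (k, i * n + b)) * F (i * n + b) =
          of_real (euler_block A B m 0 i $ e k $ e b) * F (i * n + b)"
        using entry True by simp
    qed
    also have "\<dots> = (\<Sum>i\<in>{0, m}. \<Sum>b<n. of_real (euler_block A B m 0 i $ e k $ e b) * F (i * n + b))"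
      by (rule sum.mono_neutral_right) (auto simp: euler_block_def)
    also have "\<dots> = (\<Sum>b<n. of_real (euler_block A B m 0 0 $ e k $ e b) * F b)
        + (\<Sum>b<n. of_real (euler_block A B m 0 m $ e k $ e b) * F (m * n + b))"
      using m by simp
    also have "(\<Sum>b<n. of_real (euler_block A B m 0 0 $ e k $ e b) * F b) =
        (\<Sum>b<n. (if k = b then F b else 0) + of_real (A $ e k $ e b) * F b / of_nat m)"
      using True e_iff
      by (intro sum.cong refl)
        (auto simp: euler_block_def Finite_Cartesian_Product.mat_def algebra_simps)
    also have "\<dots> = F k + (\<Sum>b<n. of_real (A $ e k $ e b) * F b) / of_nat m"
      using True by (simp add: sum.distrib sum_divide_distrib)
    also have "(\<Sum>b<n. of_real (euler_block A B m 0 m $ e k $ e b) * F (m * n + b)) =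
        (\<Sum>b<n. of_real (B $ e k $ e b) * F (m * n + b)) / of_nat m"
      using m by (simp add: euler_block_def sum_divide_distrib)
    finally show ?thesis
      using True by (simp add: n_def e_def sum.distrib add_divide_distrib)
  next
    case False
    have "complex_of_real (euler_matrix A B m $$ (k, j)) * F j = (if k - n = j then F j else 0)"
      if j: "j < (m + 1) * n" for j
    proof -
      \<comment> \<open>Subtracting \<open>n\<close> lowers the block number by one and keeps the
        offset, so only the identity block on the subdiagonal contributes.\<close>
      have "k - n = j \<longleftrightarrow> k div n = j div n + 1 \<and> k mod n = j mod n"
        using False n0
        by (metis Suc_eq_plus1 add_diff_inverse_nat div_add_self1 div_mod_decomp mod_add_self1
          add.commute less_numeral_extra(3) nat_neq_iff diff_add_inverse2)
      moreover have "k div n \<noteq> 0" using False n0 by (simp add: div_eq_0_iff)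
      moreover have "e (k mod n) = e (j mod n) \<longleftrightarrow> k mod n = j mod n"
        using n0 e_iff by simp
      ultimately show ?thesis
        unfolding entry[OF j] by (auto simp: euler_block_def Finite_Cartesian_Product.mat_def)
    qed
    then have "(\<Sum>j<(m + 1) * n. complex_of_real (euler_matrix A B m $$ (k, j)) * F j) =
        (\<Sum>j<(m + 1) * n. if k - n = j then F j else 0)"
      by (intro sum.cong) auto
    also have "\<dots> = F (k - n)" using k' by simp
    finally show ?thesis using False by (simp add: n_def)
  qed
qed

text \<open>A free variable \<open>w\<close> in place of \<open>exp (- \<mu>)\<close> lets one
  polynomial in \<open>x\<close> and \<open>w\<close> cover both the delay equation and the
  scheme.\<close>

definition char_det :: "real ^ 'n ^ 'n \<Rightarrow> real ^ 'n ^ 'n \<Rightarrow> complex \<Rightarrow> complex \<Rightarrow> complex" where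
  "char_det A B x w =
     Determinants.det (Finite_Cartesian_Product.mat x - map_matrix complex_of_real A
       - map_matrix (\<lambda>b. complex_of_real b * w) B)"

lemma char_fun_eq: "char_fun A B \<mu> = char_det A B \<mu> (exp (- \<mu>))"
  by (simp add: char_fun_def char_det_def)

text \<open>Column operations of determinant 1 make \<open>\<rho> I - C\<close> block upper
  triangular. The upper left block is the characteristic matrix of the scheme divided by
  \<open>m\<close>; the lower right one is lower triangular with \<open>\<rho>\<close> on its
  diagonal.\<close>

lemma char_poly_euler_matrix:
  fixes A B :: "real ^ 'n ^ 'n"
  assumes m: "m \<ge> 1" and l0: "\<rho> \<noteq> 0"
  defines "n \<equiv> CARD('n)"
  shows "poly (char_poly (map_mat complex_of_real (euler_matrix A B m))) \<rho> =
    \<rho> ^ (m * n) * char_det A B (of_nat m * (\<rho> - 1)) (inverse \<rho> ^ m) / of_nat m ^ n"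
proof -
  define N where "N = (m + 1) * n"
  define e where "e = from_nat_into (UNIV :: 'n set)"
  define C where "C = map_mat complex_of_real (euler_matrix A B m)"
  define w where "w = inverse \<rho> ^ m"
  have n0: "n > 0" by (simp add: n_def)
  have e_iff: "e i = e j \<longleftrightarrow> i = j" if "i < n" "j < n" for i j
    using that to_nat_on_UNIV_eq_iff[where 'n='n] unfolding n_def e_def by metis
  have C: "C \<in> carrier_mat N N" by (simp add: C_def N_def n_def euler_matrix_def carrier_matI)
  have N: "N = n + m * n" by (simp add: N_def)
  define M where "M = - char_matrix C \<rho>"
  have M: "M \<in> carrier_mat N N" using C by (simp add: M_def)
  have M_entry: "M $$ (k, j) = (if k = j then \<rho> else 0) - of_real (euler_matrix A B m $$ (k, j))"
    if "k < N" "j < N" for k j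
  proof -
    have "dim_row (euler_matrix A B m) = N" "dim_col (euler_matrix A B m) = N"
      by (simp_all add: euler_matrix_def N_def n_def)
    then show ?thesis using that C by (auto simp: M_def char_matrix_def C_def)
  qed
  \<comment> \<open>Multiplying by \<open>U\<close> adds \<open>\<rho> ^ (-i)\<close> times the \<open>i\<close>-th block column to the first one, which
    clears it below its top block because \<open>(1, \<rho> ^ (-1), \<dots>, \<rho> ^ (-m))\<close> solves the shift
    equations.\<close>
  define u where "u j l = (if l < n then (if j mod n = l then inverse \<rho> ^ (j div n) else 0)
      else if j = l then 1 else 0)" for j l
  define U where "U = Matrix.mat N N (\<lambda>(j, l). u j l)"
  have U: "U \<in> carrier_mat N N" by (simp add: U_def)
  have detU: "Determinant.det U = 1"
  proof -
    have "Determinant.det U = prod_list (diag_mat U)"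
      by (rule det_lower_triangular[OF _ U]) (auto simp: U_def u_def)
    also have "\<dots> = 1"
      using U by (auto simp: prod_list_diag_prod U_def u_def intro!: prod.neutral)
    finally show ?thesis .
  qed
  have MU: "(M * U) $$ (k, l) = \<rho> * u k l -
     (if k < n
      then u k l + (\<Sum>b<n. of_real (A $ e k $ e b) * u b l
        + of_real (B $ e k $ e b) * u (m * n + b) l) / of_nat m
      else u (k - n) l)" if kl: "k < N" "l < N" for k l
  proof -
    have "(M * U) $$ (k, l) = (\<Sum>j<N. M $$ (k, j) * u j l)"
      using kl M U by (simp add: scalar_prod_def U_def lessThan_atLeast0)
    also have "\<dots> = (\<Sum>j<N. (if k = j then \<rho> * u j l else 0) - of_real (euler_matrix A B m $$ (k, j)) * u j l)"
      using kl by (intro sum.cong) (auto simp: M_entry algebra_simps)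
    also have "\<dots> = \<rho> * u k l - (\<Sum>j<N. of_real (euler_matrix A B m $$ (k, j)) * u j l)"
      using kl by (simp add: sum_subtractf)
    finally show ?thesis
      using euler_matrix_row[OF m, where k = k and A = A and B = B and F = "\<lambda>j. u j l"] kl
      by (simp add: N_def n_def e_def)
  qed
  \<comment> \<open>The arguments \<open>m * (\<rho> - 1)\<close> and \<open>w\<close> arise by
    taking the factor \<open>1 / m\<close> out of
    \<open>(\<rho> - 1) I - (A + w B) / m\<close>.\<close>
  define R where "R = (inverse (of_nat m) :: complex) \<cdot>\<^sub>m Matrix.mat n n (\<lambda>(i, j).
     (Finite_Cartesian_Product.mat (of_nat m * (\<rho> - 1)) - map_matrix complex_of_real A
       - map_matrix (\<lambda>b. complex_of_real b * w) B) $ e i $ e j)"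
  define X where "X = Matrix.mat n (m * n) (\<lambda>(k, l). (M * U) $$ (k, l + n))"
  define T where "T = Matrix.mat (m * n) (m * n)
    (\<lambda>(k, l). (if k = l then \<rho> else 0) - (if k = l + n then 1 else 0))"
  have "M * U = four_block_mat R X (0\<^sub>m (m * n) n) T"
  proof (rule eq_matI)
    fix k l assume "k < dim_row (four_block_mat R X (0\<^sub>m (m * n) n) T)"
      "l < dim_col (four_block_mat R X (0\<^sub>m (m * n) n) T)"
    then have kl: "k < N" "l < N" by (simp_all add: R_def T_def N)
    have m0: "(of_nat m :: complex) \<noteq> 0" using m by simp
    consider "k < n" "l < n" | "k < n" "l \<ge> n" | "k \<ge> n" "l < n" | "k \<ge> n" "l \<ge> n" by linarith
    then show "(M * U) $$ (k, l) = four_block_mat R X (0\<^sub>m (m * n) n) T $$ (k, l)"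
    proof cases
      case 1
      have "(\<Sum>b<n. of_real (A $ e k $ e b) * u b l + of_real (B $ e k $ e b) * u (m * n + b) l) =
          (\<Sum>b<n. if b = l then of_real (A $ e k $ e b) + of_real (B $ e k $ e b) * w else 0)"
        using 1 n0 by (intro sum.cong) (auto simp: u_def w_def)
      also have "\<dots> = of_real (A $ e k $ e l) + of_real (B $ e k $ e l) * w"
        using 1 by simp
      finally have "(M * U) $$ (k, l) = (\<rho> - 1) * (if k = l then 1 else 0)
          - (of_real (A $ e k $ e l) + of_real (B $ e k $ e l) * w) / of_nat m"
        using 1 kl by (simp add: MU u_def algebra_simps)
      also have "\<dots> = R $$ (k, l)"
        using 1 m0 e_iff by (auto simp: R_def Finite_Cartesian_Product.mat_def field_simps)
      finally show ?thesis using 1 kl by (simp add: R_def T_def N)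
    next
      case 2
      then show ?thesis using kl by (simp add: R_def X_def T_def N)
    next
      case 3
      have "k div n = Suc ((k - n) div n)" "k mod n = (k - n) mod n"
        using 3 n0 by (simp_all add: le_div_geq le_mod_geq)
      then have "\<rho> * u k l = u (k - n) l" using 3 l0 by (simp add: u_def)
      then show ?thesis using 3 kl by (simp add: MU R_def T_def N)
    next
      case 4
      then show ?thesis using kl by (auto simp: MU u_def R_def T_def N)
    qed
  qed (use M U in \<open>simp_all add: R_def T_def N\<close>)
  then have "Determinant.det M * Determinant.det U = Determinant.det R * Determinant.det T"
    using det_mult[OF M U] det_four_block_mat_lower_left_zero[of R n X "m * n" "0\<^sub>m (m * n) n" T]
    by (simp add: R_def X_def T_def)
  moreover have "Determinant.det T = \<rho> ^ (m * n)"
  proof -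
    have "Determinant.det T = prod_list (diag_mat T)"
      by (rule det_lower_triangular[of "m * n"]) (auto simp: T_def)
    also have "\<dots> = \<rho> ^ (m * n)"
      using n0 by (simp add: prod_list_diag_prod T_def)
    finally show ?thesis .
  qed
  moreover have "Determinant.det R = char_det A B (of_nat m * (\<rho> - 1)) w / of_nat m ^ n"
    unfolding R_def Determinant.det_smult char_det_def det_mat_from_nat_into[symmetric]
    by (simp add: n_def e_def field_simps)
  moreover have "poly (char_poly C) \<rho> = Determinant.det M"
    unfolding M_def by (rule char_poly_matrix[OF C])
  ultimately show ?thesis using detU by (simp add: C_def w_def)
qed

section \<open>Geometric multiplicity of the eigenvalue 1\<close>

lemma kernel_dim_eq_1I:
  fixes M :: "'a::field mat"
  assumes M: "M \<in> carrier_mat nr nc" and u: "u \<in> mat_kernel M" "u \<noteq> 0\<^sub>v nc"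
    and span: "\<And>v. v \<in> mat_kernel M \<Longrightarrow> \<exists>a. v = a \<cdot>\<^sub>v u"
  shows "kernel_dim M = 1"
proof -
  interpret kernel nr nc M by unfold_locales (rule M)
  have "u \<in> Ker.span {u}" using u by (intro Ker.span_self) auto
  then have "a \<cdot>\<^sub>v u \<in> Ker.span {u}" for a
    using submodule.smult_closed[OF Ker.span_is_submodule, of "{u}" a u] u by auto
  then have "v \<in> Ker.span {u}" if "v \<in> mat_kernel M" for v
    using span[OF that] by auto
  moreover have "Ker.span {u} \<subseteq> mat_kernel M"
    using Ker.span_is_subset2[of "{u}"] u by auto
  ultimately have "Ker.gen_set {u}" by auto
  then have "Ker.dim = 1" using u by (intro Ker.dim1I[of u]) auto
  then show ?thesis by simp
qed

lemma dim_eq_1_imp_span: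
  fixes S :: "'a::euclidean_space set"
  assumes "Real_Vector_Spaces.subspace S" "dim S = 1"
  obtains v where "v \<in> S" "v \<noteq> 0" "\<And>x. x \<in> S \<Longrightarrow> \<exists>c. x = c *\<^sub>R v"
proof -
  obtain b where b: "b \<subseteq> S" "independent b" "S \<subseteq> span b" "card b = dim S"
    by (rule basis_exists)
  then obtain v where v: "b = {v}" using assms(2) by (auto simp: card_1_singleton_iff)
  show ?thesis
  proof (rule that[of v])
    show "v \<in> S" using b v by simp
    show "v \<noteq> 0" using b v by (auto simp: dependent_zero)
    show "\<exists>c. x = c *\<^sub>R v" if "x \<in> S" for x
      using that b v by (auto simp: span_singleton)
  qed
qed

text \<open>The shift rows force a fixed vector to repeat a single block, and the first block row
  then puts this block into the kernel of \<open>A + B\<close>. Since \<open>A + B\<close> is real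
  with a real line as kernel, its complex kernel is a complex line.\<close>

lemma kernel_dim_euler_matrix:
  fixes A B :: "real ^ 'n ^ 'n"
  assumes m: "m \<ge> 1" and "zero_root_geom_mult A B = 1"
  shows "kernel_dim (char_matrix (map_mat complex_of_real (euler_matrix A B m)) 1) = 1"
proof -
  define n where "n = CARD('n)"
  define N where "N = (m + 1) * n"
  define e where "e = from_nat_into (UNIV :: 'n set)"
  define C where "C = map_mat complex_of_real (euler_matrix A B m)"
  define M where "M = char_matrix C 1"
  have n0: "n > 0" by (simp add: n_def)
  have e: "bij_betw e {..<n} UNIV"
    using bij_betw_from_nat_into_finite[of "UNIV :: 'n set"] by (simp add: e_def n_def)
  have C: "C \<in> carrier_mat N N" by (simp add: C_def N_def n_def euler_matrix_def carrier_matI)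
  have M: "M \<in> carrier_mat N N" using C by (simp add: M_def)
  have m0: "(of_nat m :: complex) \<noteq> 0" using m by simp
  obtain z where z: "(A + B) *v z = 0" "z \<noteq> 0" "\<And>x. (A + B) *v x = 0 \<Longrightarrow> \<exists>c. x = c *\<^sub>R z"
  proof (rule dim_eq_1_imp_span)
    show "Real_Vector_Spaces.subspace {x. (A + B) *v x = 0}"
      by (auto simp: real_vector.subspace_def matrix_vector_right_distrib matrix_vector_mult_scaleR)
    show "dim {x. (A + B) *v x = 0} = 1"
      using assms(2) by (simp add: zero_root_geom_mult_def)
  qed auto
  have mult: "vec_index (M *\<^sub>v v) k = (if k < n
      then (\<Sum>b<n. of_real (A $ e k $ e b) * vec_index v b
        + of_real (B $ e k $ e b) * vec_index v (m * n + b)) / of_nat m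
      else vec_index v (k - n) - vec_index v k)"
    if v: "v \<in> carrier_vec N" and k: "k < N" for v k
  proof -
    have dims: "dim_row (euler_matrix A B m) = N" "dim_col (euler_matrix A B m) = N"
      by (simp_all add: euler_matrix_def N_def n_def)
    have "vec_index (M *\<^sub>v v) k = (\<Sum>j<N. M $$ (k, j) * vec_index v j)"
      using M v k by (simp add: scalar_prod_def lessThan_atLeast0)
    also have "\<dots> = (\<Sum>j<N. of_real (euler_matrix A B m $$ (k, j)) * vec_index v j
        - (if k = j then vec_index v j else 0))"
      using k dims by (intro sum.cong) (auto simp: M_def char_matrix_def C_def algebra_simps)
    also have "\<dots> = (\<Sum>j<N. of_real (euler_matrix A B m $$ (k, j)) * vec_index v j) - vec_index v k"
      using k by (simp add: sum_subtractf)
    finally show ?thesis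
      using euler_matrix_row[OF m, where k = k and A = A and B = B and F = "vec_index v"] k
      by (simp add: N_def n_def e_def)
  qed
  have matvec: "((A + B) *v x) $ a = (\<Sum>b<n. ((A + B) $ a $ e b) * x $ e b)" for x a
    unfolding matrix_vector_mult_def by (simp add: sum.reindex_bij_betw[OF e, symmetric])
  \<comment> \<open>The constant history: every block equals the real kernel vector
    \<open>z\<close>.\<close>
  define u where "u = Matrix.vec N (\<lambda>k. complex_of_real (z $ e (k mod n)))"
  have u: "u \<in> carrier_vec N" by (simp add: u_def)
  have "kernel_dim M = 1"
  proof (rule kernel_dim_eq_1I[OF M])
    have "M *\<^sub>v u = 0\<^sub>v N"
    proof (rule eq_vecI)
      fix k assume "k < dim_vec (0\<^sub>v N :: complex Matrix.vec)"
      then have k: "k < N" by simp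
      show "vec_index (M *\<^sub>v u) k = vec_index (0\<^sub>v N) k"
      proof (cases "k < n")
        case True
        have "(\<Sum>b<n. of_real (A $ e k $ e b) * vec_index u b
              + of_real (B $ e k $ e b) * vec_index u (m * n + b)) =
            of_real (\<Sum>b<n. ((A + B) $ e k $ e b) * z $ e b)"
          unfolding of_real_sum by (intro sum.cong) (auto simp: u_def N_def algebra_simps)
        also have "\<dots> = of_real (((A + B) *v z) $ e k)" by (simp only: matvec)
        also have "\<dots> = 0" by (simp add: z(1))
        finally show ?thesis using True k u by (simp add: mult)
      next
        case False
        then have "(k - n) mod n = k mod n" using le_mod_geq[of n k] by simp
        then show ?thesis using False k u by (simp add: mult u_def)
      qed
    qed (use M in simp)
    then show "u \<in> mat_kernel M" using M u by (intro mat_kernelI)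
    show "u \<noteq> 0\<^sub>v N"
    proof
      assume "u = 0\<^sub>v N"
      moreover have "vec_index u k = of_real (z $ e k)" if "k < n" for k
        using that by (simp add: u_def N_def)
      ultimately have "z $ e k = 0" if "k < n" for k
        using that by (simp add: N_def)
      then have "z $ a = 0" for a using e by (auto simp: bij_betw_def) (metis UNIV_I imageE lessThan_iff)
      then show False using z(2) by (simp add: Finite_Cartesian_Product.vec_eq_iff)
    qed
    fix v assume "v \<in> mat_kernel M"
    then have v: "v \<in> carrier_vec N" and Mv: "M *\<^sub>v v = 0\<^sub>v N"
      using mat_kernelD[OF M] by auto
    have zero: "vec_index (M *\<^sub>v v) k = 0" if "k < N" for k
      using that by (simp add: Mv)
    \<comment> \<open>Each shift row equates a coordinate with the one a block earlier; descending
      by \<open>n\<close> ends in the first block.\<close>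
    have per: "vec_index v k = vec_index v (k mod n)" if "k < N" for k
      using that
    proof (induction k rule: less_induct)
      case (less k)
      show ?case
      proof (cases "k < n")
        case False
        then have "vec_index v k = vec_index v (k - n)"
          using mult[OF v less.prems] zero[OF less.prems] by simp
        also have "\<dots> = vec_index v ((k - n) mod n)"
          using False n0 less by (intro less.IH) auto
        finally show ?thesis using False le_mod_geq[of n k] by simp
      qed simp
    qed
    have kern: "(\<Sum>b<n. of_real ((A + B) $ e k $ e b) * vec_index v b) = 0" if "k < n" for k
    proof -
      have "(\<Sum>b<n. of_real ((A + B) $ e k $ e b) * vec_index v b) =
        (\<Sum>b<n. of_real (A $ e k $ e b) * vec_index v b + of_real (B $ e k $ e b) * vec_index v (m * n + b))"
      proof (intro sum.cong refl)
        fix b assume "b \<in> {..<n}"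
        then have "vec_index v (m * n + b) = vec_index v b" using per[of "m * n + b"] by (simp add: N_def)
        then show "of_real ((A + B) $ e k $ e b) * vec_index v b =
            of_real (A $ e k $ e b) * vec_index v b + of_real (B $ e k $ e b) * vec_index v (m * n + b)"
          by (simp add: algebra_simps)
      qed
      also have "\<dots> = 0" using mult[OF v, of k] zero[of k] that m0 by (simp add: N_def)
      finally show ?thesis .
    qed
    define i where "i = inv_into {..<n} e"
    have ie: "i (e b) = b" if "b < n" for b
      using bij_betw_inv_into_left[OF e, of b] that by (simp add: i_def)
    have surj: "\<exists>k<n. a = e k" for a using e by (auto simp: bij_betw_def)
    \<comment> \<open>Here \<open>g\<close> stands for \<open>Re\<close> and \<open>Im\<close>.
      Being real linear, it passes through a sum with real coefficients, so both parts of a complex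
      solution solve the real system.\<close>
    have "\<exists>c. (\<chi> a. g (vec_index v (i a))) = c *\<^sub>R z"
      if g: "bounded_linear g" "\<And>r c. g (of_real r * c) = r * g c" for g :: "complex \<Rightarrow> real"
    proof (rule z(3))
      show "(A + B) *v (\<chi> a. g (vec_index v (i a))) = 0"
      proof (subst Finite_Cartesian_Product.vec_eq_iff, intro allI)
        fix a
        obtain k where k: "k < n" "a = e k" using surj by blast
        have "((A + B) *v (\<chi> a. g (vec_index v (i a)))) $ a =
            g (\<Sum>b<n. of_real ((A + B) $ e k $ e b) * vec_index v b)"
          unfolding matvec linear_sum[OF bounded_linear.linear[OF g(1)]] k(2) g(2)
          by (intro sum.cong) (auto simp: ie)
        then show "((A + B) *v (\<chi> a. g (vec_index v (i a)))) $ a = 0 $ a"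
          using kern[OF k(1)] linear_0[OF bounded_linear.linear[OF g(1)]] by simp
      qed
    qed
    from this[OF bounded_linear_Re] this[OF bounded_linear_Im]
    obtain c d where cd: "(\<chi> a. Re (vec_index v (i a))) = c *\<^sub>R z" "(\<chi> a. Im (vec_index v (i a))) = d *\<^sub>R z"
      by auto
    have vz: "vec_index v b = Complex c d * of_real (z $ e b)" if "b < n" for b
    proof -
      have "Re (vec_index v (i (e b))) = c * z $ e b" "Im (vec_index v (i (e b))) = d * z $ e b"
        using arg_cong[OF cd(1), of "\<lambda>x. x $ e b"] arg_cong[OF cd(2), of "\<lambda>x. x $ e b"] by simp_all
      then show ?thesis using that by (simp add: ie complex_eq_iff)
    qed
    have "v = Complex c d \<cdot>\<^sub>v u"
    proof (rule eq_vecI)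
      fix k assume "k < dim_vec (Complex c d \<cdot>\<^sub>v u)"
      then have k: "k < N" by (simp add: u_def)
      then show "vec_index v k = vec_index (Complex c d \<cdot>\<^sub>v u) k"
        using per[OF k] vz[of "k mod n"] n0 by (simp add: u_def)
    qed (use u v in auto)
    then show "\<exists>a. v = a \<cdot>\<^sub>v u" by blast
  qed
  then show ?thesis by (simp add: M_def C_def)
qed

section \<open>Zeros of holomorphic functions: factoring, persistence and uniqueness of the
  order\<close>

text \<open>Dividing by \<open>z\<close> twice, each time with the derivative filled in at 0, keeps
  the function entire; no remainder is left because \<open>f\<close> and its derivative vanish at
  0.\<close>

lemma double_zero_factor:
  assumes "f holomorphic_on UNIV" "f 0 = 0" "deriv f 0 = 0"
  obtains h where "h holomorphic_on UNIV" "\<And>z. f z = z\<^sup>2 * h z"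
proof -
  define g where "g = (\<lambda>z. if z = 0 then deriv f 0 else (f z - f 0) / (z - 0))"
  have g: "g holomorphic_on UNIV"
    unfolding g_def by (rule pole_lemma_open[OF assms(1) open_UNIV])
  define h where "h = (\<lambda>z. if z = 0 then deriv g 0 else (g z - g 0) / (z - 0))"
  have "h holomorphic_on UNIV"
    unfolding h_def by (rule pole_lemma_open[OF g open_UNIV])
  moreover have "f z = z\<^sup>2 * h z" for z
    using assms(2,3) by (simp add: h_def g_def power2_eq_square)
  ultimately show ?thesis by (rule that)
qed

text \<open>On a nonempty compact set the norm of \<open>F\<close> has a positive minimum, and
  uniform closeness within that minimum excludes zeros.\<close>

lemma eventually_nonzero_uniform_limit:
  fixes f :: "'i \<Rightarrow> 'a::topological_space \<Rightarrow> 'b::real_normed_vector"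
  assumes "uniform_limit S f F l" "compact S" "continuous_on S F" "\<And>z. z \<in> S \<Longrightarrow> F z \<noteq> 0"
  shows "\<forall>\<^sub>F k in l. \<forall>z\<in>S. f k z \<noteq> 0"
proof (cases "S = {}")
  case False
  obtain y where y: "y \<in> S" "\<And>z. z \<in> S \<Longrightarrow> norm (F y) \<le> norm (F z)"
    using continuous_attains_inf[OF assms(2) False continuous_on_norm[OF assms(3)]] by blast
  have "norm (F y) > 0" using y(1) assms(4) by simp
  from uniform_limitD[OF assms(1) this] show ?thesis
  proof eventually_elim
    case (elim k)
    show ?case
    proof
      fix z assume z: "z \<in> S"
      show "f k z \<noteq> 0" using elim z y(2)[OF z] by (auto simp: dist_norm)
    qed
  qed
qed simp

text \<open>
  Dividing by \<open>z\<^sup>2\<close> is harmless on the circle, and the maximum principle carries the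
  convergence of the quotients into the disc, zero included.
\<close>

lemma double_zero_stable:
  fixes f :: "nat \<Rightarrow> complex \<Rightarrow> complex"
  assumes r: "r > 0"
    and f: "\<And>k. f k holomorphic_on UNIV" "\<And>k. f k 0 = 0" "\<And>k. deriv (f k) 0 = 0"
    and g: "g holomorphic_on cball 0 r" "\<And>z. z \<in> cball 0 r \<Longrightarrow> F z = z\<^sup>2 * g z"
      "\<And>z. z \<in> cball 0 r \<Longrightarrow> g z \<noteq> 0"
    and lim: "uniform_limit (sphere 0 r) f F sequentially"
  shows "\<forall>\<^sub>F k in sequentially. \<exists>h. h holomorphic_on UNIV \<and> (\<forall>z. f k z = z\<^sup>2 * h z) \<and>
    (\<forall>z\<in>cball 0 r. h z \<noteq> 0)"
proof -
  have "\<exists>h. h holomorphic_on UNIV \<and> (\<forall>z. f k z = z\<^sup>2 * h z)" for k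
    using double_zero_factor[OF f] by metis
  then obtain h where h: "\<And>k. h k holomorphic_on UNIV" "\<And>k z. f k z = z\<^sup>2 * h k z" by metis
  have "uniform_limit (cball 0 r) h g sequentially"
  proof (rule uniform_limitI)
    fix \<epsilon> :: real assume \<epsilon>: "\<epsilon> > 0"
    \<comment> \<open>On the circle \<open>f k - F\<close> is \<open>r\<^sup>2\<close> times as
      large as \<open>h k - g\<close>. The half leaves room for the strict inequality, as the
      maximum principle only yields \<open>\<le>\<close>.\<close>
    then have "\<epsilon> / 2 * r\<^sup>2 > 0" using r by simp
    from uniform_limitD[OF lim this]
    show "\<forall>\<^sub>F k in sequentially. \<forall>z\<in>cball 0 r. dist (h k z) (g z) < \<epsilon>"
    proof eventually_elim
      case (elim k)
      have bd: "norm (h k z - g z) \<le> \<epsilon> / 2" if z: "norm z = r" for z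
      proof -
        have "norm (f k z - F z) = r\<^sup>2 * norm (h k z - g z)"
          using z g(2)[of z] h(2)[of k z]
          by (simp add: norm_mult norm_power flip: right_diff_distrib)
        moreover have "norm (f k z - F z) < \<epsilon> / 2 * r\<^sup>2"
          using elim z by (simp add: dist_norm)
        ultimately have "r\<^sup>2 * norm (h k z - g z) < r\<^sup>2 * (\<epsilon> / 2)" by (simp add: mult.commute)
        then show ?thesis using r by (simp add: mult_less_cancel_left)
      qed
      have "norm (h k z - g z) \<le> \<epsilon> / 2" if z: "z \<in> cball 0 r" for z
      proof (rule maximum_modulus_frontier[where S = "cball 0 r" and f = "\<lambda>z. h k z - g z"])
        have hol: "(\<lambda>z. h k z - g z) holomorphic_on cball 0 r"
          using h(1) g(1) by (intro holomorphic_on_diff) (auto intro: holomorphic_on_subset)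
        then show "(\<lambda>z. h k z - g z) holomorphic_on interior (cball 0 r)"
          by (rule holomorphic_on_subset) (rule interior_subset)
        show "continuous_on (closure (cball 0 r)) (\<lambda>z. h k z - g z)"
          using holomorphic_on_imp_continuous_on[OF hol] by simp
        show "bounded (cball (0::complex) r)" by simp
      qed (use z bd in auto)
      then show ?case using \<epsilon> by (fastforce simp: dist_norm)
    qed
  qed
  then have "\<forall>\<^sub>F k in sequentially. \<forall>z\<in>cball 0 r. h k z \<noteq> 0"
    by (rule eventually_nonzero_uniform_limit)
      (use g in \<open>auto intro: holomorphic_on_imp_continuous_on\<close>)
  then show ?thesis by eventually_elim (use h in blast)
qed

text \<open>If \<open>k > j\<close>, cancelling \<open>z ^ j\<close> away from 0 leaves
  \<open>c z\<close> with a factor \<open>z\<close>, so \<open>c\<close> tends to 0 there, against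
  continuity and \<open>c 0 \<noteq> 0\<close>. The other inequality is symmetric.\<close>

lemma power_factor_unique:
  fixes c d :: "complex \<Rightarrow> complex"
  assumes "\<And>z. z ^ j * c z = z ^ k * d z" "isCont c 0" "isCont d 0" "c 0 \<noteq> 0" "d 0 \<noteq> 0"
  shows "j = k"
proof -
  have le: "k \<le> j"
    if cd: "\<And>z. z ^ j * c z = z ^ k * d z" "isCont c 0" "isCont d 0" "c 0 \<noteq> 0"
    for j k :: nat and c d :: "complex \<Rightarrow> complex"
  proof (rule ccontr)
    assume "\<not> k \<le> j"
    then have k: "k = j + Suc (k - Suc j)" by simp
    have eq: "c z = z * (z ^ (k - Suc j) * d z)" if "z \<noteq> 0" for z
    proof -
      have "z ^ j * c z = z ^ j * (z * (z ^ (k - Suc j) * d z))"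
        by (subst cd(1), subst k) (simp only: power_add power_Suc mult.assoc)
      then show ?thesis using that by simp
    qed
    have "((\<lambda>z. z * (z ^ (k - Suc j) * d z)) \<longlongrightarrow> 0 * (0 ^ (k - Suc j) * d 0)) (at 0)"
      using cd(3) by (intro tendsto_intros) (auto simp: isCont_def)
    then have "((\<lambda>z. z * (z ^ (k - Suc j) * d z)) \<longlongrightarrow> 0) (at 0)" by simp
    then have "(c \<longlongrightarrow> 0) (at 0)"
      by (rule Lim_transform_eventually) (auto simp: eventually_at_filter eq)
    then show False using cd(2,4) LIM_unique by (auto simp: isCont_def)
  qed
  show ?thesis using le[of j c k d] le[of k d j c] assms by (metis antisym)
qed

section \<open>The difference quotient of the exponential\<close>

text \<open>Writing \<open>m * (exp (z / m) - 1)\<close> as \<open>z * expquot (z / m)\<close> turns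
  the limit of large \<open>m\<close> into continuity of an entire function at 0, where its value is
  1.\<close>

definition expquot :: "complex \<Rightarrow> complex" where
  "expquot z = (if z = 0 then 1 else (exp z - 1) / z)"

lemma expquot_0 [simp]: "expquot 0 = 1"
  by (simp add: expquot_def)

lemma mult_expquot: "z * expquot z = exp z - 1"
  by (simp add: expquot_def)

lemma holomorphic_expquot: "expquot holomorphic_on UNIV"
proof -
  have "expquot = (\<lambda>z. if z = 0 then deriv exp 0 else (exp z - exp 0) / (z - 0))"
    by (auto simp: expquot_def fun_eq_iff DERIV_imp_deriv[OF DERIV_exp])
  then show ?thesis using pole_lemma_open[OF holomorphic_on_exp open_UNIV, of 0] by simp
qed

lemma continuous_on_expquot [continuous_intros]:
  "continuous_on S f \<Longrightarrow> continuous_on S (\<lambda>x. expquot (f x))"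
  using holomorphic_on_imp_continuous_on[OF holomorphic_expquot]
  by (rule continuous_on_compose2) auto

text \<open>The quotient vanishes only at the nonzero multiples of \<open>2 * pi * \<i>\<close>.\<close>

lemma expquot_lower_bound:
  obtains c where "c > 0" "\<And>\<theta>. \<bar>\<theta>\<bar> \<le> pi \<Longrightarrow> c \<le> norm (expquot (\<i> * of_real \<theta>))"
proof -
  have "continuous_on {-pi..pi} (\<lambda>\<theta>. norm (expquot (\<i> * of_real \<theta>)))"
    by (intro continuous_intros)
  from continuous_attains_inf[OF compact_Icc _ this]
  obtain y where y: "y \<in> {-pi..pi}"
    "\<And>\<theta>. \<theta> \<in> {-pi..pi} \<Longrightarrow> norm (expquot (\<i> * of_real y)) \<le> norm (expquot (\<i> * of_real \<theta>))"
    by auto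
  have "expquot (\<i> * of_real y) \<noteq> 0"
  proof
    assume *: "expquot (\<i> * of_real y) = 0"
    then have y0: "y \<noteq> 0" by auto
    have "exp (\<i> * of_real y) = 1" using * y0 by (simp add: expquot_def split: if_splits)
    then obtain n :: int where n: "y = of_int (2 * n) * pi" by (auto simp: exp_eq_1)
    have "n \<noteq> 0" using n y0 by auto
    then have "\<bar>of_int (2 * n) :: real\<bar> \<ge> 2" by linarith
    then have "2 * pi \<le> \<bar>y\<bar>" by (simp add: n abs_mult)
    then show False using y(1) pi_gt_zero unfolding atLeastAtMost_iff by linarith
  qed
  then show ?thesis
    using y(2) by (intro that[of "norm (expquot (\<i> * of_real y))"]) (simp_all add: abs_le_iff minus_le_iff)
qed

section \<open>The characteristic determinant in two independent variables\<close>

text \<open>The Leibniz formula exhibits a polynomial in \<open>x\<close> and \<open>w\<close>;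
  continuity, holomorphy and joint differentiability are all read off from it.\<close>

lemma char_det_expand:
  "char_det A B x w = (\<Sum>p | p permutes (UNIV :: 'n set). of_int (sign p) *
     (\<Prod>i\<in>UNIV. (if i = p i then x else 0) - of_real (A $ i $ p i) - of_real (B $ i $ p i) * w))"
  for A B :: "real ^ 'n ^ 'n"
  by (simp add: char_det_def Determinants.det_def Finite_Cartesian_Product.mat_def)

lemma continuous_on_char_det [continuous_intros]:
  assumes "continuous_on S f" "continuous_on S g"
  shows "continuous_on S (\<lambda>z. char_det A B (f z) (g z))"
proof -
  have "continuous_on S (\<lambda>z. if P then f z else 0)" for P
    using assms(1) by (cases P) auto
  then show ?thesis unfolding char_det_expand by (intro continuous_intros assms)
qed

lemma holomorphic_on_char_det [holomorphic_intros]: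
  assumes "f holomorphic_on S" "g holomorphic_on S"
  shows "(\<lambda>z. char_det A B (f z) (g z)) holomorphic_on S"
proof -
  have "(\<lambda>z. if P then f z else 0) holomorphic_on S" for P
    using assms(1) by (cases P) auto
  then show ?thesis unfolding char_det_expand by (intro holomorphic_intros assms)
qed

lemma char_det_differentiable:
  "(\<lambda>(x, w). char_det A B x w) differentiable (at p)"
proof -
  have ite: "(\<lambda>p::complex \<times> complex. if P then fst p else 0) differentiable (at p)" for P
    by (cases P) (auto intro: bounded_linear_imp_differentiable bounded_linear_fst)
  have prod: "(\<lambda>p. \<Prod>i\<in>I. g i p) differentiable (at p)"
    if "\<And>i. i \<in> I \<Longrightarrow> g i differentiable (at p)"
    for I and g :: "'i \<Rightarrow> complex \<times> complex \<Rightarrow> complex"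
    using that by (induction I rule: infinite_finite_induct) auto
  have entry: "(\<lambda>p::complex \<times> complex. (if P then fst p else 0) - a - b * snd p) differentiable (at p)"
    for P a b
    by (intro differentiable_diff differentiable_mult differentiable_const ite
        bounded_linear_imp_differentiable[OF bounded_linear_snd])
  show ?thesis
    unfolding char_det_expand case_prod_beta
    by (rule differentiable_sum) (auto intro!: differentiable_mult prod entry)
qed

text \<open>By the chain rule the derivative at 0 depends only on the base point and the velocity of
  the curve, and the two curves share both.\<close>

lemma deriv_char_det_along_tangent_curves:
  assumes x: "(x has_field_derivative d) (at 0)" and y: "(y has_field_derivative d) (at 0)"
    and w: "(w has_field_derivative e) (at 0)" and eq: "x 0 = y 0"
  shows "deriv (\<lambda>z. char_det A B (x z) (w z)) 0 = deriv (\<lambda>z. char_det A B (y z) (w z)) 0"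
proof -
  obtain D where D: "((\<lambda>(x, w). char_det A B x w) has_derivative D) (at (y 0, w 0))"
    using char_det_differentiable differentiable_def by blast
  have *: "((\<lambda>z. char_det A B (v z) (w z)) has_derivative (\<lambda>h. D (d * h, e * h))) (at 0)"
    if v: "(v has_field_derivative d) (at 0)" "v 0 = y 0" for v
  proof -
    have "((\<lambda>z. (v z, w z)) has_derivative (\<lambda>h. (d * h, e * h))) (at 0)"
      using v w by (auto intro!: has_derivative_Pair simp: has_field_derivative_def)
    from has_derivative_compose[OF this, of "\<lambda>(x, w). char_det A B x w" D] D v(2)
    show ?thesis by simp
  qed
  \<comment> \<open>Equality of \<open>deriv\<close> follows once both functions have the same field
    derivatives \<open>c\<close>, so the real derivative \<open>D\<close> never has to be shown
    complex linear.\<close>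
  have "((\<lambda>z. char_det A B (x z) (w z)) has_field_derivative c) (at 0) \<longleftrightarrow>
      ((\<lambda>z. char_det A B (y z) (w z)) has_field_derivative c) (at 0)" for c
    using *[OF x eq] *[OF y refl] has_derivative_unique
    unfolding has_field_derivative_def by metis
  then show ?thesis by (simp add: deriv_def)
qed

text \<open>A root makes \<open>x\<close> an eigenvalue of \<open>A + w B\<close>. Adding up the row
  estimates for an eigenvector with sum norm \<open>s\<close> gives
  \<open>norm x * s \<le> K * s\<close>, with \<open>K\<close> independent of
  \<open>w\<close>.\<close>

lemma char_det_root_bound:
  fixes A B :: "real ^ 'n ^ 'n"
  assumes "char_det A B x w = 0" "norm w \<le> 1"
  shows "norm x \<le> (\<Sum>i\<in>UNIV. \<Sum>j\<in>UNIV. \<bar>A $ i $ j\<bar> + \<bar>B $ i $ j\<bar>)"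
proof -
  define M where "M = Finite_Cartesian_Product.mat x - map_matrix complex_of_real A
       - map_matrix (\<lambda>b. complex_of_real b * w) B"
  define K where "K = (\<Sum>i\<in>UNIV. \<Sum>j\<in>UNIV. \<bar>A $ i $ j\<bar> + \<bar>B $ i $ j\<bar>)"
  have "\<not> invertible M"
    using assms(1) by (simp add: invertible_det_nz M_def char_det_def)
  then obtain v where v: "M *v v = 0" "v \<noteq> 0"
    using matrix_left_invertible_ker[of M] invertible_left_inverse[of M] by blast
  define s where "s = (\<Sum>j\<in>UNIV. norm (v $ j))"
  have s: "s > 0"
  proof -
    obtain j where "v $ j \<noteq> 0" using v(2) by (auto simp: Finite_Cartesian_Product.vec_eq_iff)
    then show ?thesis unfolding s_def by (intro sum_pos2[of _ j]) auto
  qed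
  have vj: "norm (v $ j) \<le> s" for j
    unfolding s_def by (rule member_le_sum) auto
  have row: "x * v $ i = (\<Sum>j\<in>UNIV. (of_real (A $ i $ j) + of_real (B $ i $ j) * w) * v $ j)" for i
  proof -
    have "0 = (M *v v) $ i" using v by simp
    also have "\<dots> = (\<Sum>j\<in>UNIV. (if i = j then x * v $ j else 0)
        - (of_real (A $ i $ j) + of_real (B $ i $ j) * w) * v $ j)"
      unfolding matrix_vector_mult_def M_def
      by (auto simp: Finite_Cartesian_Product.mat_def algebra_simps intro!: sum.cong)
    also have "\<dots> = x * v $ i - (\<Sum>j\<in>UNIV. (of_real (A $ i $ j) + of_real (B $ i $ j) * w) * v $ j)"
      by (simp add: sum_subtractf)
    finally show ?thesis by simp
  qed
  have "norm x * norm (v $ i) \<le> (\<Sum>j\<in>UNIV. \<bar>A $ i $ j\<bar> + \<bar>B $ i $ j\<bar>) * s" for i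
  proof -
    have "norm x * norm (v $ i) = norm (\<Sum>j\<in>UNIV. (of_real (A $ i $ j) + of_real (B $ i $ j) * w) * v $ j)"
      by (simp add: norm_mult flip: row)
    also have "\<dots> \<le> (\<Sum>j\<in>UNIV. (\<bar>A $ i $ j\<bar> + \<bar>B $ i $ j\<bar>) * s)"
    proof (rule sum_norm_le)
      fix j
      have "norm (of_real (A $ i $ j) + of_real (B $ i $ j) * w) \<le> \<bar>A $ i $ j\<bar> + \<bar>B $ i $ j\<bar> * norm w"
        by (rule norm_triangle_le) (simp add: norm_mult)
      also have "\<dots> \<le> \<bar>A $ i $ j\<bar> + \<bar>B $ i $ j\<bar>"
        using assms(2) by (simp add: mult_left_le)
      finally show "norm ((of_real (A $ i $ j) + of_real (B $ i $ j) * w) * v $ j)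
            \<le> (\<bar>A $ i $ j\<bar> + \<bar>B $ i $ j\<bar>) * s"
        unfolding norm_mult using vj s by (intro mult_mono) auto
    qed
    finally show ?thesis by (simp only: sum_distrib_right)
  qed
  then have "(\<Sum>i\<in>UNIV. norm x * norm (v $ i)) \<le> (\<Sum>i\<in>UNIV. (\<Sum>j\<in>UNIV. \<bar>A $ i $ j\<bar> + \<bar>B $ i $ j\<bar>) * s)"
    by (intro sum_mono)
  then have "norm x * s \<le> K * s"
    by (simp add: s_def K_def flip: sum_distrib_left sum_distrib_right)
  then show ?thesis using s by (simp add: K_def)
qed

section \<open>The characteristic function of the scheme and its limit\<close>

text \<open>
  The characteristic function of the scheme with step size \<open>1 / m\<close>, in the variable \<open>\<mu>\<close>
  with \<open>\<rho> = exp (\<mu> / m)\<close>.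
\<close>

definition euler_char_fun :: "real ^ 'n ^ 'n \<Rightarrow> real ^ 'n ^ 'n \<Rightarrow> nat \<Rightarrow> complex \<Rightarrow> complex" where
  "euler_char_fun A B m \<mu> = char_det A B (\<mu> * expquot (\<mu> / of_nat m)) (exp (- \<mu>))"

lemma holomorphic_euler_char_fun: "euler_char_fun A B m holomorphic_on UNIV"
proof -
  have "expquot \<circ> (\<lambda>z. z / of_nat m) holomorphic_on UNIV"
    by (rule holomorphic_on_compose_gen[OF _ holomorphic_expquot])
      (auto simp: divide_inverse intro!: holomorphic_intros)
  then show ?thesis
    unfolding euler_char_fun_def comp_def by (intro holomorphic_intros)
qed

text \<open>With \<open>t = 1 / m\<close> as a second variable, both functions are slices of one
  function \<open>H\<close> that is continuous, hence uniformly continuous, on the compact set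
  \<open>S \<times> {0..1}\<close>; the slice at \<open>t = 0\<close> is the limit.\<close>

lemma uniform_limit_euler_char_fun:
  assumes "compact S"
  shows "uniform_limit S (euler_char_fun A B) (char_fun A B) sequentially"
proof (rule uniform_limitI)
  fix \<epsilon> :: real assume \<epsilon>: "\<epsilon> > 0"
  define H where "H = (\<lambda>(z, t). char_det A B (z * expquot (z * of_real t)) (exp (- z)))"
  have "compact (S \<times> {0..1::real})" by (intro compact_Times assms compact_Icc)
  moreover have "continuous_on (S \<times> {0..1::real}) H"
    unfolding H_def case_prod_beta by (intro continuous_intros)
  ultimately have "uniformly_continuous_on (S \<times> {0..1::real}) H"
    by (rule compact_uniformly_continuous[rotated])
  then obtain \<delta> where \<delta>: "\<delta> > 0"
    "\<And>p q. p \<in> S \<times> {0..1} \<Longrightarrow> q \<in> S \<times> {0..1} \<Longrightarrow> dist q p < \<delta> \<Longrightarrow> dist (H q) (H p) < \<epsilon>"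
    using \<epsilon> unfolding uniformly_continuous_on_def by blast
  have "\<forall>\<^sub>F m in sequentially. inverse (real m) < \<delta>"
    using LIMSEQ_inverse_real_of_nat \<delta>(1) lim_inverse_n order_tendstoD(2) by blast
  then show "\<forall>\<^sub>F m in sequentially. \<forall>z\<in>S. dist (euler_char_fun A B m z) (char_fun A B z) < \<epsilon>"
  proof eventually_elim
    case (elim m)
    show ?case
    proof
      fix z assume z: "z \<in> S"
      \<comment> \<open>For \<open>m = 0\<close> the inverse is 0 by convention and still lies in
        the unit interval.\<close>
      have "inverse (real m) \<le> 1" by (cases m) (auto simp: inverse_le_1_iff)
      then have "dist (H (z, inverse (real m))) (H (z, 0)) < \<epsilon>"
        using z elim by (intro \<delta>(2)) (auto simp: dist_Pair_Pair)
      then show "dist (euler_char_fun A B m z) (char_fun A B z) < \<epsilon>"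
        by (simp add: H_def euler_char_fun_def char_fun_eq divide_inverse)
    qed
  qed
qed

text \<open>With \<open>\<rho> = exp (z / m)\<close> the arguments take the form in which they occur
  in \<open>char_poly_euler_matrix\<close>.\<close>

lemma euler_char_fun_simps:
  assumes "m \<ge> 1"
  shows "euler_char_fun A B m z =
    char_det A B (of_nat m * (exp (z / of_nat m) - 1)) (inverse (exp (z / of_nat m)) ^ m)"
proof -
  have "z * expquot (z / of_nat m) = of_nat m * (exp (z / of_nat m) - 1)"
    using assms mult_expquot[of "z / of_nat m"] by (simp add: field_simps)
  moreover have "inverse (exp (z / of_nat m)) ^ m = exp (- z)"
    using assms by (simp add: exp_of_nat_mult[symmetric] flip: exp_minus)
  ultimately show ?thesis by (simp add: euler_char_fun_def)
qed

lemma euler_char_fun_0: "euler_char_fun A B m 0 = char_fun A B 0"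
  by (simp add: euler_char_fun_def char_fun_eq)

text \<open>The curves \<open>z * expquot (z / m)\<close> and \<open>z\<close> both pass through 0
  with velocity 1, since \<open>expquot 0 = 1\<close>.\<close>

lemma deriv_euler_char_fun_0: "deriv (euler_char_fun A B m) 0 = deriv (char_fun A B) 0"
proof -
  have "expquot field_differentiable (at 0)"
    using holomorphic_expquot by (auto simp: holomorphic_on_def)
  then have "((\<lambda>z. expquot (z / of_nat m)) has_field_derivative deriv expquot 0 * (1 / of_nat m)) (at 0)"
    by (intro DERIV_chain2[where f = expquot and g = "\<lambda>z. z / of_nat m"])
      (auto simp: field_differentiable_derivI intro: DERIV_cdivide DERIV_ident)
  then have "((\<lambda>z. z * expquot (z / of_nat m)) has_field_derivative 1) (at 0)"
    by (auto intro!: derivative_eq_intros)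
  then have "deriv (\<lambda>z. char_det A B (z * expquot (z / of_nat m)) (exp (- z))) 0 =
      deriv (\<lambda>z. char_det A B z (exp (- z))) 0"
    by (rule deriv_char_det_along_tangent_curves[where e = "-1"])
      (auto intro!: derivative_eq_intros)
  then show ?thesis by (simp add: euler_char_fun_def[abs_def] char_fun_eq[abs_def])
qed

text \<open>Two regions are combined. In a disc around 0 the double zero is eventually the only
  zero; on the imaginary axis outside it, the root bound confines zeros to a compact set on which
  the limit does not vanish.\<close>

lemma eventually_euler_char_fun:
  assumes zero: "char_fun A B 0 = 0" and mult: "root_alg_mult A B 0 = 2"
    and roots: "\<And>\<mu>. char_fun A B \<mu> = 0 \<Longrightarrow> \<mu> \<noteq> 0 \<Longrightarrow> Re \<mu> \<noteq> 0"
  shows "\<forall>\<^sub>F m in sequentially.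
    (\<exists>h. h holomorphic_on UNIV \<and> h 0 \<noteq> 0 \<and> (\<forall>z. euler_char_fun A B m z = z\<^sup>2 * h z)) \<and>
    (\<forall>\<theta>. \<bar>\<theta>\<bar> \<le> pi \<longrightarrow> \<theta> \<noteq> 0 \<longrightarrow> euler_char_fun A B m (of_nat m * (\<i> * of_real \<theta>)) \<noteq> 0)"
proof -
  have hol: "char_fun A B holomorphic_on UNIV"
    unfolding char_fun_eq[abs_def] by (intro holomorphic_intros)
  \<comment> \<open>The point \<open>\<i>\<close> is nonzero with real part 0, hence not a root; so
    the function is not identically zero and has a finite order at 0.\<close>
  have "\<exists>w\<in>UNIV. char_fun A B w \<noteq> 0" using roots[of \<i>] by auto
  from zorder_exist_zero[OF hol open_UNIV connected_UNIV UNIV_I[of 0] this] mult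
  obtain r g where r: "r > 0" and g: "g holomorphic_on cball 0 r"
    "\<And>z. z \<in> cball 0 r \<Longrightarrow> char_fun A B z = z\<^sup>2 * g z" "\<And>z. z \<in> cball 0 r \<Longrightarrow> g z \<noteq> 0"
    unfolding root_alg_mult_def by (auto simp: mult.commute[of "_\<^sup>2"])
  have "deriv (char_fun A B) 0 = 0"
  proof (rule DERIV_imp_deriv)
    have "g field_differentiable (at 0)"
      using g(1) r by (intro holomorphic_on_imp_differentiable_at[of _ "ball 0 r"])
        (auto intro: holomorphic_on_subset)
    then have "((\<lambda>z. z\<^sup>2 * g z) has_field_derivative 0) (at 0)"
      by (auto simp: field_differentiable_def intro!: derivative_eq_intros)
    then show "(char_fun A B has_field_derivative 0) (at 0)"
      by (rule has_field_derivative_transform_within_open[of _ _ _ "ball 0 r"]) (use g r in auto)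
  qed
  then have factor: "\<forall>\<^sub>F m in sequentially. \<exists>h. h holomorphic_on UNIV \<and>
      (\<forall>z. euler_char_fun A B m z = z\<^sup>2 * h z) \<and> (\<forall>z\<in>cball 0 r. h z \<noteq> 0)"
    using g zero
    by (intro double_zero_stable[OF r holomorphic_euler_char_fun _ _ _ _ _ uniform_limit_euler_char_fun])
      (auto simp: euler_char_fun_0 deriv_euler_char_fun_0)
  obtain c where c: "c > 0" "\<And>\<theta>. \<bar>\<theta>\<bar> \<le> pi \<Longrightarrow> c \<le> norm (expquot (\<i> * of_real \<theta>))"
    using expquot_lower_bound by blast
  define K where "K = (\<Sum>i\<in>UNIV. \<Sum>j\<in>UNIV. \<bar>A $ i $ j\<bar> + \<bar>B $ i $ j\<bar>)"
  \<comment> \<open>The radius comes from \<open>c * norm \<mu> \<le> norm (\<mu> * expquot (\<i> *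
    \<theta>)) \<le> K\<close>. Removing an open ball keeps the set compact.\<close>
  define S where "S = cball 0 (K / c) \<inter> {z. Re z = 0} - ball 0 r"
  have "compact S"
    unfolding S_def
    by (intro compact_diff compact_Int_closed compact_cball open_ball closed_Collect_eq continuous_intros)
  moreover have "char_fun A B z \<noteq> 0" if "z \<in> S" for z
    using roots[of z] that r by (cases "z = 0") (auto simp: S_def)
  moreover have "continuous_on S (char_fun A B)"
    using hol by (auto intro: holomorphic_on_imp_continuous_on holomorphic_on_subset)
  ultimately have "\<forall>\<^sub>F m in sequentially. \<forall>z\<in>S. euler_char_fun A B m z \<noteq> 0"
    by (intro eventually_nonzero_uniform_limit[OF uniform_limit_euler_char_fun])
  moreover have "\<forall>\<^sub>F m in sequentially. m \<ge> (1::nat)" by (rule eventually_ge_at_top)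
  ultimately show ?thesis
    using factor
  proof eventually_elim
    case (elim m)
    obtain h where h: "h holomorphic_on UNIV" "\<And>z. euler_char_fun A B m z = z\<^sup>2 * h z"
      "\<And>z. z \<in> cball 0 r \<Longrightarrow> h z \<noteq> 0" using elim(3) by blast
    have "euler_char_fun A B m (of_nat m * (\<i> * of_real \<theta>)) \<noteq> 0" if \<theta>: "\<bar>\<theta>\<bar> \<le> pi" "\<theta> \<noteq> 0" for \<theta>
    proof
      define \<mu> where "\<mu> = of_nat m * (\<i> * complex_of_real \<theta>)"
      assume "euler_char_fun A B m (of_nat m * (\<i> * of_real \<theta>)) = 0"
      then have z: "euler_char_fun A B m \<mu> = 0" by (simp add: \<mu>_def)
      have q: "\<mu> / of_nat m = \<i> * of_real \<theta>" and "\<mu> \<noteq> 0" and re: "Re \<mu> = 0"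
        using elim(2) \<theta>(2) by (auto simp: \<mu>_def)
      \<comment> \<open>On the imaginary axis \<open>exp (- \<mu>)\<close> has norm 1, so the root
        bound applies with \<open>w = exp (- \<mu>)\<close>.\<close>
      have "norm (\<mu> * expquot (\<i> * of_real \<theta>)) \<le> K"
        unfolding K_def using z re q
        by (intro char_det_root_bound[where w = "exp (- \<mu>)"]) (auto simp: euler_char_fun_def)
      moreover have "norm \<mu> * c \<le> norm (\<mu> * expquot (\<i> * of_real \<theta>))"
        using c(2)[OF \<theta>(1)] by (simp add: norm_mult mult_left_mono)
      ultimately have "norm \<mu> \<le> K / c" using c(1) by (simp add: pos_le_divide_eq)
      then have "\<mu> \<in> S \<or> \<mu> \<in> cball 0 r" using re by (auto simp: S_def)
      then show False using elim(1) z h(2,3)[of \<mu>] \<open>\<mu> \<noteq> 0\<close> by auto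
    qed
    moreover have "h 0 \<noteq> 0" using h(3) r by simp
    ultimately show ?case using h by blast
  qed
qed

section \<open>Algebraic multiplicity of the eigenvalue 1 and assembly of the resonance\<close>

text \<open>Under \<open>\<rho> = exp (z / m)\<close> the factor \<open>(\<rho> - 1) ^ k\<close>
  becomes \<open>z ^ k\<close> times a function that is nonzero at 0. The order at
  \<open>\<rho> = 1\<close> is therefore the order in \<open>z\<close> at 0.\<close>

lemma order_1_eq_2I:
  fixes p :: "complex poly"
  assumes m: "m \<ge> 1" and p: "\<And>z. poly p (exp (z / of_nat m)) = z\<^sup>2 * c z"
    and c: "isCont c 0" "c 0 \<noteq> 0"
  shows "Polynomial.order 1 p = 2"
proof -
  have "p \<noteq> 0"
  proof
    assume "p = 0"
    then have "c z = 0" if "z \<noteq> 0" for z using p[of z] that by simp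
    then have "(c \<longlongrightarrow> 0) (at 0)"
      by (intro tendsto_eventually) (auto simp: eventually_at_filter)
    then show False using c LIM_unique by (auto simp: isCont_def)
  qed
  then obtain q where q: "p = [:- 1, 1:] ^ Polynomial.order 1 p * q" "\<not> [:- 1, 1:] dvd q"
    using order_decomp by blast
  define k where "k = Polynomial.order 1 p"
  \<comment> \<open>The cofactor of \<open>z ^ k\<close>: away from 0,
    \<open>expquot (z / m) / m\<close> is \<open>(exp (z / m) - 1) / z\<close>.\<close>
  define d where "d z = (expquot (z / of_nat m) / of_nat m) ^ k * poly q (exp (z / of_nat m))" for z
  have "z ^ k * d z = z\<^sup>2 * c z" for z
  proof -
    have "poly p (exp (z / of_nat m)) = (exp (z / of_nat m) - 1) ^ k * poly q (exp (z / of_nat m))"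
      by (subst q(1)) (simp add: k_def)
    also have "exp (z / of_nat m) - 1 = z * (expquot (z / of_nat m) / of_nat m)"
      using mult_expquot[of "z / of_nat m"] by simp
    finally show ?thesis by (simp add: p d_def power_mult_distrib power_divide)
  qed
  moreover have "isCont d 0"
  proof -
    have "continuous_on UNIV d"
      unfolding d_def using m by (intro continuous_intros) auto
    then show ?thesis by (simp add: continuous_on_eq_continuous_at)
  qed
  moreover have "poly q 1 \<noteq> 0" using q(2) by (simp add: poly_eq_0_iff_dvd)
  then have "d 0 \<noteq> 0" using m by (simp add: d_def)
  ultimately have "k = 2" using c by (intro power_factor_unique[where c = d and d = c]) auto
  then show ?thesis by (simp add: k_def)
qed

theorem theorem4p1:
  fixes f :: "real ^ 'n \<Rightarrow> real ^ 'n \<Rightarrow> real ^ 2 \<Rightarrow> real ^ 'n"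
    and A B :: "real ^ 'n ^ 'n" and r :: nat
  assumes "r \<ge> 2"
    and "Ck r (\<lambda>(z1, z2, \<alpha>). f z1 z2 \<alpha>)"
    and "\<And>\<alpha>. f 0 0 \<alpha> = 0"
    and "A = jacobian (\<lambda>z1. f z1 0 0) (at 0)"
    and "B = jacobian (\<lambda>z2. f 0 z2 0) (at 0)"
    and "char_fun A B 0 = 0"
    and "root_alg_mult A B 0 = 2"
    and "zero_root_geom_mult A B = 1"
    and "\<And>\<mu>. char_fun A B \<mu> = 0 \<Longrightarrow> \<mu> \<noteq> 0 \<Longrightarrow> Re \<mu> \<noteq> 0"
  shows "\<exists>m0\<ge>1. \<forall>m\<ge>m0. one_one_resonance ((m + 1) * CARD('n)) (euler_map f m)"
proof -
  define n where "n = CARD('n)"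
  \<comment> \<open>One level of \<open>Ck\<close> gives the total derivative at the origin;
    composing with the embedding \<open>(x, y, 0)\<close> restricts it to parameter 0.\<close>
  obtain r' where "r = Suc r'" using assms(1) by (cases r) auto
  then have "(\<lambda>(z1, z2, \<alpha>). f z1 z2 \<alpha>) differentiable
      (at ((0, 0, 0) :: (real ^ 'n) \<times> (real ^ 'n) \<times> (real ^ 2)))"
    using assms(2) by simp
  then obtain D where D: "((\<lambda>(z1, z2, \<alpha>). f z1 z2 \<alpha>) has_derivative D) (at (0, 0, 0))"
    unfolding differentiable_def by blast
  have "((\<lambda>(x, y). (x, y, 0 :: real ^ 2)) has_derivative (\<lambda>(x, y). (x, y, 0)))
      (at (0 :: real ^ 'n, 0 :: real ^ 'n))"
    unfolding case_prod_beta by (auto intro!: derivative_eq_intros)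
  from has_derivative_compose[OF this, of "\<lambda>(z1, z2, \<alpha>). f z1 z2 \<alpha>" D] D
  have diff: "(\<lambda>(x, y). f x y 0) differentiable (at (0, 0))"
    unfolding differentiable_def case_prod_unfold by auto
  have "\<forall>\<^sub>F m in sequentially.
    (\<exists>h. h holomorphic_on UNIV \<and> h 0 \<noteq> 0 \<and> (\<forall>z. euler_char_fun A B m z = z\<^sup>2 * h z)) \<and>
    (\<forall>\<theta>. \<bar>\<theta>\<bar> \<le> pi \<longrightarrow> \<theta> \<noteq> 0 \<longrightarrow> euler_char_fun A B m (of_nat m * (\<i> * of_real \<theta>)) \<noteq> 0)"
    using assms(6,7,9) by (rule eventually_euler_char_fun)
  moreover have "\<forall>\<^sub>F m in sequentially. m \<ge> (1::nat)" by (rule eventually_ge_at_top)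
  ultimately have "\<forall>\<^sub>F m in sequentially. one_one_resonance ((m + 1) * CARD('n)) (euler_map f m)"
  proof eventually_elim
    case (elim m)
    define N where "N = (m + 1) * n"
    define C where "C = map_mat complex_of_real (euler_matrix A B m)"
    have lin: "linearization_at_0 N (euler_map f m 0) = euler_matrix A B m"
      unfolding N_def n_def assms(4,5) by (rule linearization_euler_map[where f = f, OF diff elim(2)])
    have C: "C \<in> carrier_mat N N" by (simp add: C_def N_def n_def euler_matrix_def carrier_matI)
    have m0: "(of_nat m :: complex) \<noteq> 0" using elim(2) by simp
    have poly: "poly (char_poly C) (exp (z / of_nat m)) =
        exp (z / of_nat m) ^ (m * n) * euler_char_fun A B m z / of_nat m ^ n" for z
      unfolding C_def n_def euler_char_fun_simps[OF elim(2)]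
      by (rule char_poly_euler_matrix[OF elim(2)]) simp
    obtain h where h: "h holomorphic_on UNIV" "h 0 \<noteq> 0"
      "\<And>z. euler_char_fun A B m z = z\<^sup>2 * h z" using elim(1) by blast
    have order: "Polynomial.order 1 (char_poly C) = 2"
    proof (rule order_1_eq_2I[OF elim(2)])
      show "poly (char_poly C) (exp (z / of_nat m)) =
          z\<^sup>2 * (exp (z / of_nat m) ^ (m * n) * h z / of_nat m ^ n)" for z
        by (simp add: poly h)
      have "isCont h 0"
        using holomorphic_on_imp_continuous_on[OF h(1)] by (simp add: continuous_on_eq_continuous_at)
      then show "isCont (\<lambda>z. exp (z / of_nat m) ^ (m * n) * h z / of_nat m ^ n) 0"
        using m0 by (intro continuous_intros) auto
    qed (use h m0 in simp)
    have "poly (char_poly C) 1 = 0" using poly[of 0] h(3)[of 0] by simp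
    then have eig: "eigenvalue C 1" by (simp add: eigenvalue_root_char_poly[OF C])
    have unit: "\<rho> = 1" if \<rho>: "eigenvalue C \<rho>" "cmod \<rho> = 1" for \<rho>
    proof (rule ccontr)
      assume "\<rho> \<noteq> 1"
      \<comment> \<open>The principal argument places the eigenvalue at
        \<open>\<mu> = m * \<i> * \<theta>\<close> with
        \<open>\<bar>\<theta>\<bar> \<le> pi\<close>, the range in which zeros have been
        excluded.\<close>
      define \<theta> where "\<theta> = Arg \<rho>"
      have "\<rho> \<noteq> 0" using \<rho>(2) by auto
      from Arg_eq[OF this] have exp: "\<rho> = exp (\<i> * of_real \<theta>)"
        unfolding \<rho>(2) \<theta>_def by (simp only: of_real_1 mult_1)
      have "\<theta> \<noteq> 0"
      proof
        assume "\<theta> = 0"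
        then show False using \<open>\<rho> \<noteq> 1\<close> unfolding exp by simp
      qed
      moreover have "\<bar>\<theta>\<bar> \<le> pi"
        using Arg_bounded[of \<rho>] unfolding \<theta>_def by linarith
      ultimately have \<theta>: "\<bar>\<theta>\<bar> \<le> pi" "\<theta> \<noteq> 0" by blast+
      have "poly (char_poly C) \<rho> = 0" using \<rho>(1) by (simp add: eigenvalue_root_char_poly[OF C])
      then have "euler_char_fun A B m (of_nat m * (\<i> * of_real \<theta>)) = 0"
        using poly[of "of_nat m * (\<i> * of_real \<theta>)"] m0 \<open>\<rho> \<noteq> 0\<close> by (simp flip: exp)
      then show False using elim(1) \<theta> by blast
    qed
    have ker: "kernel_dim (char_matrix C 1) = 1"
      unfolding C_def by (rule kernel_dim_euler_matrix[OF elim(2) assms(8)])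
    have "one_one_resonance N (euler_map f m)"
      unfolding one_one_resonance_def Let_def lin C_def[symmetric]
      by (intro conjI allI impI eig order ker) (auto intro: unit)
    then show ?case by (simp only: N_def n_def)
  qed
  then obtain m0 where "\<forall>m\<ge>m0. one_one_resonance ((m + 1) * CARD('n)) (euler_map f m)"
    by (auto simp: eventually_sequentially)
  then show ?thesis by (intro exI[of _ "max 1 m0"]) auto
qed

end
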